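(* Let $G$ be a biautomatic group with an automatic structure $L_1$ for $\pi_1:A^*\to G$ and an f-biautomatic (i.e. factorial biautomatic) structure $L_2$ for $\pi_2:B^*\to G$ admitting some departure function $D$. Let $\varphi$ be an endomorphism of $G$ such that there is some $N\in\mathbb N$ satisfying the following condition: for every $\alpha\in L_1$ and $x\in G$, we have $\mathrm{Im}(\theta_\alpha^x\varphi)\subseteq\mathcal V_N(\mathrm{Im}(\theta_\beta^{x\varphi}))$ for every $\beta\in L_2$ such that $\beta\pi_2=\alpha\pi_1\varphi$. Then the FT-BRP holds for $(\varphi,L_1,L_2)$.
   Context: Maps are written on the right. Let $A$ be a finite alphabet and $\pi:A^*\to G$ a surjective (monoid) homomorphism onto a group $G$. $d_A$ denotes the geodesic (word) metric on the Cayley graph $\Gamma_A(G)$ of $G$ with respect to $A\pi$. For a word $u$, $u^{[n]}$ is its prefix with $n$ letters, and $u^{[n]}=u$ if $n>|u|$. $u\diamond v$ is the unique word over $(A\times A)\cup(A\times\{\$\})\cup(\{\$\}\times A)$ whose projection to the first (resp. second) component lies in $u\$^*$ (resp. $v\$^*$). An automatic structure for $\pi$ is a rational language $L\subseteq A^*$ with $L\pi=G$ such that for each $x\in A\cup\{1\}$ the language $\{u\diamond v\mid u,v\in L, v\pi=(ux)\pi\}$ is recognized by a finite state automaton; it is biautomatic if in addition each $\{u\diamond v\mid u,v\in L, v\pi=(xu)\pi\}$ is recognized by a finite state automaton. (Equivalently: rational sections satisfying the fellow traveller property, respectively its variant in which paths labelled by words of $L$ may also start at distance at most one.) A structure is factorial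 if it is closed under taking factors (contiguous subwords). A group is biautomatic if it has a biautomatic structure. A departure function for $(G,L)$ is a function $D:\mathbb R_{\ge0}\to\mathbb R_{\ge 0}$ such that if $w\in L$, $r,s\ge0$, $t\ge D(r)$ and $s+t\le|w|$, then $d_A(w^{[s]}\pi,w^{[s+t]}\pi)>r$ (with $s,t$ integers). For a word $u$ and $x\in G$, $\theta_u^x:\{0,\dots,|u|\}\to G$ is $n\mapsto x(u^{[n]}\pi)$ ($\pi$ the relevant homomorphism). $\mathcal V_\varepsilon(Y)=\{x\mid d(x,Y)\le\varepsilon\}$, with respect to the word metric $d_A$ (another finite generating set only changes $N$). Words $u,v\in A^*$ $p$-fellow travel in $\Gamma_A(G)$ if $d_A(u^{[n]}\pi,v^{[n]}\pi)\le p$ for all $n\in\mathbb N$; they are $p$-MFT (meeting fellow travellers) if moreover $u\pi=v\pi$. The FT-BRP holds for $(\varphi,L_1,L_2)$ if for every $p\ge 0$ there is $q\ge0$ such that: whenever $u_i\in L_1$ and $u_i'\in L_2$ with $u_i'\pi_2=u_i\pi_1\varphi$ for $i=1,2,3$, if $u_1u_2$ and $u_3$ are $p$-MFT in $\Gamma_A(G)$, then $u_1'u_2'$ and $u_3'$ are $q$-MFT in $\Gamma_B(G)$. *)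

theory Defs
  imports Complex_Main "HOL-Algebra.Group"
begin

section \<open>Rational and recognizable languages\<close>

inductive rational :: "'c set \<Rightarrow> 'c list set \<Rightarrow> bool" for X :: "'c set" where
  rat_empty: "rational X {}"
| rat_eps: "rational X {[]}"
| rat_letter: "a \<in> X \<Longrightarrow> rational X {[a]}"
| rat_union: "rational X K \<Longrightarrow> rational X L \<Longrightarrow> rational X (K \<union> L)"
| rat_prod: "rational X K \<Longrightarrow> rational X L \<Longrightarrow> rational X {u @ v | u v. u \<in> K \<and> v \<in> L}"
| rat_star: "rational X K \<Longrightarrow> rational X (concat ` lists K)"

text \<open>Nondeterministic automata; states are natural numbers without loss of generality.\<close>

record 'c fsa =
  states :: "nat set"
  initial :: "nat set"
  transitions :: "(nat \<times> 'c \<times> nat) set"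
  final :: "nat set"

definition is_fsa :: "'c set \<Rightarrow> 'c fsa \<Rightarrow> bool" where
  "is_fsa X M \<longleftrightarrow> finite (states M) \<and> initial M \<subseteq> states M \<and> final M \<subseteq> states M
     \<and> transitions M \<subseteq> states M \<times> X \<times> states M"

inductive run :: "'c fsa \<Rightarrow> nat \<Rightarrow> 'c list \<Rightarrow> nat \<Rightarrow> bool" for M :: "'c fsa" where
  run_Nil: "run M p [] p"
| run_Cons: "(p, c, q) \<in> transitions M \<Longrightarrow> run M q w r \<Longrightarrow> run M p (c # w) r"

definition fsa_language :: "'c fsa \<Rightarrow> 'c list set" where
  "fsa_language M = {w. \<exists>p \<in> initial M. \<exists>q \<in> final M. run M p w q}"

definition recognizable :: "'c set \<Rightarrow> 'c list set \<Rightarrow> bool" where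
  "recognizable X W \<longleftrightarrow> (\<exists>M. is_fsa X M \<and> fsa_language M = W)"

section \<open>Padded pairs of words\<close>

text \<open>The padding symbol \<open>$\<close> is \<open>None\<close>; a letter \<open>a\<close> is \<open>Some a\<close>.\<close>

definition pad_alphabet :: "'a set \<Rightarrow> ('a option \<times> 'a option) set" where
  "pad_alphabet A = (Some ` A \<times> Some ` A) \<union> (Some ` A \<times> {None}) \<union> ({None} \<times> Some ` A)"

fun pad_pair :: "'a list \<Rightarrow> 'a list \<Rightarrow> ('a option \<times> 'a option) list" (infix "\<diamondop>" 65) where
  "[] \<diamondop> [] = []"
| "(a # u) \<diamondop> [] = (Some a, None) # (u \<diamondop> [])"
| "[] \<diamondop> (b # v) = (None, Some b) # ([] \<diamondop> v)"
| "(a # u) \<diamondop> (b # v) = (Some a, Some b) # (u \<diamondop> v)"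

lemma pad_pair_proj:
  "(None, None) \<notin> set (u \<diamondop> v)
   \<and> (\<exists>m. map fst (u \<diamondop> v) = map Some u @ replicate m None)
   \<and> (\<exists>n. map snd (u \<diamondop> v) = map Some v @ replicate n None)"
proof (induction u v rule: pad_pair.induct)
  case (2 a u)
  then obtain m n where "map fst (u \<diamondop> []) = map Some u @ replicate m None"
    "map snd (u \<diamondop> []) = replicate n None" by auto
  then show ?case using 2 by (auto intro: exI[of _ m] exI[of _ "Suc n"])
next
  case (3 b v)
  then obtain m n where "map snd ([] \<diamondop> v) = map Some v @ replicate m None"
    "map fst ([] \<diamondop> v) = replicate n None" by auto
  then show ?case using 3 by (auto intro: exI[of _ m] exI[of _ "Suc n"])
qed auto

lemma pad_pair_unique:
  assumes "(None, None) \<notin> set w"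
    and "map fst w = map Some u @ replicate m None"
    and "map snd w = map Some v @ replicate n None"
  shows "w = u \<diamondop> v"
  using assms
proof (induction u v arbitrary: w m n rule: pad_pair.induct)
  case 1
  then show ?case
    by (cases w; cases m; cases n) auto
next
  case (2 a u)
  then show ?case by (cases w; cases n) auto
next
  case (3 b v)
  then show ?case by (cases w; cases m) auto
next
  case (4 a u b v)
  then show ?case by (cases w) auto
qed

section \<open>Cayley graphs and word metrics\<close>

definition free_monoid :: "'a set \<Rightarrow> 'a list monoid" where
  "free_monoid A = \<lparr>carrier = lists A, mult = (@), one = []\<rparr>"

definition surj_monoid_hom :: "('g, 'm) monoid_scheme \<Rightarrow> 'a set \<Rightarrow> ('a list \<Rightarrow> 'g) \<Rightarrow> bool" where
  "surj_monoid_hom G A \<pi> \<longleftrightarrow> \<pi> \<in> epi (free_monoid A) G \<and> \<pi> [] = \<one>\<^bsub>G\<^esub>"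

definition cayley_edges :: "('g, 'm) monoid_scheme \<Rightarrow> 'a set \<Rightarrow> ('a list \<Rightarrow> 'g) \<Rightarrow> ('g \<times> 'g) set" where
  "cayley_edges G A \<pi> = {(g, g \<otimes>\<^bsub>G\<^esub> \<pi> [a]) | g a. g \<in> carrier G \<and> a \<in> A}"

text \<open>The geodesic metric: paths may traverse edges in both directions, as \<open>A\<close> is not
  assumed to be closed under inverses.\<close>

definition word_dist :: "('g, 'm) monoid_scheme \<Rightarrow> 'a set \<Rightarrow> ('a list \<Rightarrow> 'g) \<Rightarrow> 'g \<Rightarrow> 'g \<Rightarrow> nat" where
  "word_dist G A \<pi> g h =
     (LEAST n. (g, h) \<in> (cayley_edges G A \<pi> \<union> (cayley_edges G A \<pi>)\<inverse>) ^^ n)"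

text \<open>The distance to the empty set is read as infinite.\<close>

definition nbhd ::
  "('g, 'm) monoid_scheme \<Rightarrow> 'a set \<Rightarrow> ('a list \<Rightarrow> 'g) \<Rightarrow> real \<Rightarrow> 'g set \<Rightarrow> 'g set" where
  "nbhd G A \<pi> \<epsilon> Y =
     {x \<in> carrier G. Y \<noteq> {} \<and> real (INF y\<in>Y. word_dist G A \<pi> x y) \<le> \<epsilon>}"

definition theta ::
  "('g, 'm) monoid_scheme \<Rightarrow> ('a list \<Rightarrow> 'g) \<Rightarrow> 'g \<Rightarrow> 'a list \<Rightarrow> nat \<Rightarrow> 'g" where
  "theta G \<pi> x u n = x \<otimes>\<^bsub>G\<^esub> \<pi> (take n u)"

definition theta_image ::
  "('g, 'm) monoid_scheme \<Rightarrow> ('a list \<Rightarrow> 'g) \<Rightarrow> 'g \<Rightarrow> 'a list \<Rightarrow> 'g set" where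
  "theta_image G \<pi> x u = theta G \<pi> x u ` {0..length u}"

section \<open>Automatic and biautomatic structures\<close>

definition automatic_structure ::
  "('g, 'm) monoid_scheme \<Rightarrow> 'a set \<Rightarrow> ('a list \<Rightarrow> 'g) \<Rightarrow> 'a list set \<Rightarrow> bool" where
  "automatic_structure G A \<pi> L \<longleftrightarrow>
     group G \<and> finite A \<and> surj_monoid_hom G A \<pi> \<and>
     rational A L \<and> \<pi> ` L = carrier G \<and>
     (\<forall>x \<in> insert [] {[a] | a. a \<in> A}.
        recognizable (pad_alphabet A) {u \<diamondop> v | u v. u \<in> L \<and> v \<in> L \<and> \<pi> v = \<pi> (u @ x)})"

definition biautomatic_structure ::
  "('g, 'm) monoid_scheme \<Rightarrow> 'a set \<Rightarrow> ('a list \<Rightarrow> 'g) \<Rightarrow> 'a list set \<Rightarrow> bool" where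
  "biautomatic_structure G A \<pi> L \<longleftrightarrow>
     automatic_structure G A \<pi> L \<and>
     (\<forall>x \<in> insert [] {[a] | a. a \<in> A}.
        recognizable (pad_alphabet A) {u \<diamondop> v | u v. u \<in> L \<and> v \<in> L \<and> \<pi> v = \<pi> (x @ u)})"

text \<open>Any finite alphabet can be relabelled by natural numbers, so fixing the letter type
  to \<^typ>\<open>nat\<close> loses no generality.\<close>

definition biautomatic_group :: "('g, 'm) monoid_scheme \<Rightarrow> bool" where
  "biautomatic_group G \<longleftrightarrow>
     group G \<and> (\<exists>(A :: nat set) \<pi> L. biautomatic_structure G A \<pi> L)"

definition factorial_language :: "'a list set \<Rightarrow> bool" where
  "factorial_language L \<longleftrightarrow> (\<forall>x u y. x @ u @ y \<in> L \<longrightarrow> u \<in> L)"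

definition f_biautomatic_structure ::
  "('g, 'm) monoid_scheme \<Rightarrow> 'a set \<Rightarrow> ('a list \<Rightarrow> 'g) \<Rightarrow> 'a list set \<Rightarrow> bool" where
  "f_biautomatic_structure G A \<pi> L \<longleftrightarrow> biautomatic_structure G A \<pi> L \<and> factorial_language L"

definition departure_function ::
  "('g, 'm) monoid_scheme \<Rightarrow> 'a set \<Rightarrow> ('a list \<Rightarrow> 'g) \<Rightarrow> 'a list set \<Rightarrow> (real \<Rightarrow> real) \<Rightarrow> bool" where
  "departure_function G A \<pi> L D \<longleftrightarrow>
     (\<forall>r\<ge>0. D r \<ge> 0) \<and>
     (\<forall>w\<in>L. \<forall>r\<ge>0. \<forall>s t :: nat. real t \<ge> D r \<and> s + t \<le> length w \<longrightarrow>
        real (word_dist G A \<pi> (\<pi> (take s w)) (\<pi> (take (s + t) w))) > r)"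

section \<open>Fellow travelling and the bounded reduction property\<close>

definition fellow_travel ::
  "('g, 'm) monoid_scheme \<Rightarrow> 'a set \<Rightarrow> ('a list \<Rightarrow> 'g) \<Rightarrow> real \<Rightarrow> 'a list \<Rightarrow> 'a list \<Rightarrow> bool" where
  "fellow_travel G A \<pi> p u v \<longleftrightarrow>
     (\<forall>n. real (word_dist G A \<pi> (\<pi> (take n u)) (\<pi> (take n v))) \<le> p)"

definition MFT ::
  "('g, 'm) monoid_scheme \<Rightarrow> 'a set \<Rightarrow> ('a list \<Rightarrow> 'g) \<Rightarrow> real \<Rightarrow> 'a list \<Rightarrow> 'a list \<Rightarrow> bool" where
  "MFT G A \<pi> p u v \<longleftrightarrow> fellow_travel G A \<pi> p u v \<and> \<pi> u = \<pi> v"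

definition FT_BRP ::
  "('g, 'm) monoid_scheme \<Rightarrow> 'a set \<Rightarrow> ('a list \<Rightarrow> 'g) \<Rightarrow> 'b set \<Rightarrow> ('b list \<Rightarrow> 'g)
     \<Rightarrow> ('g \<Rightarrow> 'g) \<Rightarrow> 'a list set \<Rightarrow> 'b list set \<Rightarrow> bool" where
  "FT_BRP G A \<pi>\<^sub>1 B \<pi>\<^sub>2 \<phi> L\<^sub>1 L\<^sub>2 \<longleftrightarrow>
     (\<forall>p\<ge>0. \<exists>q\<ge>0. \<forall>u\<^sub>1\<in>L\<^sub>1. \<forall>u\<^sub>2\<in>L\<^sub>1. \<forall>u\<^sub>3\<in>L\<^sub>1. \<forall>v\<^sub>1\<in>L\<^sub>2. \<forall>v\<^sub>2\<in>L\<^sub>2. \<forall>v\<^sub>3\<in>L\<^sub>2.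
        \<pi>\<^sub>2 v\<^sub>1 = \<phi> (\<pi>\<^sub>1 u\<^sub>1) \<and> \<pi>\<^sub>2 v\<^sub>2 = \<phi> (\<pi>\<^sub>1 u\<^sub>2) \<and> \<pi>\<^sub>2 v\<^sub>3 = \<phi> (\<pi>\<^sub>1 u\<^sub>3) \<and>
        MFT G A \<pi>\<^sub>1 p (u\<^sub>1 @ u\<^sub>2) u\<^sub>3 \<longrightarrow> MFT G B \<pi>\<^sub>2 q (v\<^sub>1 @ v\<^sub>2) v\<^sub>3)"

end

theory Submission
  imports Defs
begin

text \<open>
  Write \<open>d\<^sub>A\<close>, \<open>d\<^sub>B\<close> for the two word metrics. Let \<open>u\<^sub>1 u\<^sub>2\<close> and \<open>u\<^sub>3\<close> be meeting
  \<open>p\<close>-fellow travellers, and let \<open>v\<^sub>i \<in> L\<^sub>2\<close> represent the image of \<open>u\<^sub>i\<close> under \<open>\<phi>\<close>. The vertices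
  \<open>1\<close>, \<open>\<pi>\<^sub>2 v\<^sub>1\<close> and \<open>\<pi>\<^sub>2 v\<^sub>3\<close> span a triangle with sides \<open>v\<^sub>1\<close>, \<open>v\<^sub>2\<close>, \<open>v\<^sub>3\<close>, and the point is that
  its corner \<open>\<pi>\<^sub>2 v\<^sub>1\<close> is close to the opposite side. Indeed the prefix of \<open>u\<^sub>3\<close> with \<open>|u\<^sub>1|\<close> letters
  ends within \<open>p\<close> of \<open>\<pi>\<^sub>1 u\<^sub>1\<close>. A homomorphism between finitely generated groups is Lipschitz
  (\<open>hom_lipschitz\<close>), so the image of this prefix is at bounded distance from \<open>\<pi>\<^sub>2 v\<^sub>1\<close>;
  by the neighbourhood hypothesis it is also at bounded distance from a vertex of the path \<open>v\<^sub>3\<close>.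

  Cut \<open>v\<^sub>3 = a b\<close> at this vertex. As \<open>L\<^sub>2\<close> is factorial, \<open>a\<close> and \<open>b\<close> are in \<open>L\<^sub>2\<close>. The paths \<open>a\<close> and
  \<open>v\<^sub>1\<close> start together and end close to each other, so they fellow travel
  (\<open>automatic_fellow_traveller\<close>). The paths \<open>b\<close> and \<open>v\<^sub>2\<close>, read from \<open>\<pi>\<^sub>2 a\<close> and \<open>\<pi>\<^sub>2 v\<^sub>1\<close>, start
  close to each other and end together; here the second half of biautomaticity is needed
  (\<open>biautomatic_fellow_traveller\<close>). Gluing the two estimates requires that \<open>|a|\<close> and \<open>|v\<^sub>1|\<close> differ
  by a bounded amount, since the second halves are otherwise read at different times. This is what
  the departure function gives: if one of \<open>a\<close>, \<open>v\<^sub>1\<close> is longer, then its part beyond the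
  length of the other joins two nearby points, and so it cannot be long (\<open>departure_bounds_excess\<close>).
\<close>

section \<open>Automata reading padded pairs\<close>

lemma rational_subset_lists: "rational X L \<Longrightarrow> L \<subseteq> lists X"
proof (induction rule: rational.induct)
  case (rat_prod K L)
  then show ?case unfolding lists_eq_set by fastforce
next
  case (rat_star K)
  then show ?case unfolding lists_eq_set by fastforce
qed auto

lemma pad_pair_inject:
  assumes "u \<diamondop> v = u' \<diamondop> v'"
  shows "u = u'" "v = v'"
proof -
  have cancel: "x = y"
    if "map Some x @ replicate m None = map Some y @ replicate n None"
    for x y :: "'c list" and m n
  proof -
    have "filter (\<lambda>c. c \<noteq> None) (map Some x @ replicate m None) =
        filter (\<lambda>c. c \<noteq> None) (map Some y @ replicate n None)"
      using that by simp
    moreover have "filter (\<lambda>c. c \<noteq> None) (map Some z) = map Some z" for z :: "'c list"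
      by (induction z) auto
    ultimately have "map Some x = map Some y" by (simp add: filter_replicate)
    then show ?thesis by (metis inj_Some inj_map_eq_map)
  qed
  show "u = u'" using pad_pair_proj[of u v] pad_pair_proj[of u' v'] assms cancel by metis
  show "v = v'" using pad_pair_proj[of u v] pad_pair_proj[of u' v'] assms cancel by metis
qed

lemma take_pad_pair: "take n (u \<diamondop> v) = take n u \<diamondop> take n v"
proof (induction u v arbitrary: n rule: pad_pair.induct)
  case (2 a u n)
  then show ?case by (cases n) auto
next
  case (3 b v n)
  then show ?case by (cases n) auto
next
  case (4 a u b v n)
  then show ?case by (cases n) auto
qed simp

lemma length_pad_pair: "length (u \<diamondop> v) = max (length u) (length v)"
  by (induction u v rule: pad_pair.induct) auto

lemma run_append: "run M p (x @ y) r \<longleftrightarrow> (\<exists>q. run M p x q \<and> run M q y r)"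
proof (induction x arbitrary: p)
  case Nil
  show ?case by (auto intro: run_Nil elim: run.cases)
next
  case (Cons c x)
  have "run M p (c # w) r \<longleftrightarrow> (\<exists>q. (p, c, q) \<in> transitions M \<and> run M q w r)" for p w r
    by (auto intro: run_Cons elim: run.cases)
  then show ?case using Cons by auto
qed

lemma run_stays_in_states:
  assumes "is_fsa X M"
  shows "run M p w q \<Longrightarrow> p \<in> states M \<Longrightarrow> q \<in> states M"
  by (induction rule: run.induct) (use assms in \<open>auto simp: is_fsa_def\<close>)

text \<open>Which words complete a given prefix depends only on the state reached. Hence one fixed
  completion for each of the finitely many states suffices, and \<open>K\<close> bounds their lengths.\<close>

lemma recognizable_bounded_completion:
  assumes "recognizable X W"
  obtains K where "\<And>x y. x @ y \<in> W \<Longrightarrow> \<exists>z. x @ z \<in> W \<and> length z \<le> K"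
proof -
  obtain M where M: "is_fsa X M" and W: "W = fsa_language M"
    using assms by (auto simp: recognizable_def)
  define c where "c q = (SOME z. \<exists>f \<in> final M. run M q z f)" for q
  define K where "K = Max (insert 0 ((\<lambda>q. length (c q)) ` states M))"
  have "\<exists>z. x @ z \<in> W \<and> length z \<le> K" if "x @ y \<in> W" for x y
  proof -
    from that obtain p q f where p: "p \<in> initial M" "run M p x q"
      and f: "f \<in> final M" "run M q y f"
      by (auto simp: W fsa_language_def run_append)
    have "\<exists>f \<in> final M. run M q (c q) f"
      unfolding c_def by (rule someI[of _ y]) (use f in blast)
    then have "x @ c q \<in> W" using p by (auto simp: W fsa_language_def run_append)
    moreover have "q \<in> states M"
      using run_stays_in_states[OF M p(2)] p(1) M by (auto simp: is_fsa_def)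
    then have "length (c q) \<le> K"
      unfolding K_def using M by (intro Max_ge) (auto simp: is_fsa_def)
    ultimately show ?thesis by blast
  qed
  then show thesis by (rule that)
qed

lemma recognizable_pairs_bounded_completion:
  assumes "recognizable X {u \<diamondop> v | u v. Q u v}"
  obtains K where "\<And>u v n. Q u v \<Longrightarrow> \<exists>u' v'. Q u' v' \<and> take n u' = take n u \<and>
    take n v' = take n v \<and> length u' \<le> n + K \<and> length v' \<le> n + K"
proof -
  obtain K where K: "\<And>x y. x @ y \<in> {u \<diamondop> v | u v. Q u v} \<Longrightarrow>
      \<exists>z. x @ z \<in> {u \<diamondop> v | u v. Q u v} \<and> length z \<le> K"
    by (rule recognizable_bounded_completion[OF assms]) (rule that)
  have "\<exists>u' v'. Q u' v' \<and> take n u' = take n u \<and>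
    take n v' = take n v \<and> length u' \<le> n + K \<and> length v' \<le> n + K" if Q: "Q u v" for u v n
  proof (cases "length (u \<diamondop> v) \<le> n")
    case True
    \<comment> \<open>A completion could put letters before position \<open>n\<close> here, so the pair itself is taken.\<close>
    then show ?thesis using Q by (intro exI[of _ u] exI[of _ v]) (simp add: length_pad_pair)
  next
    case False
    have "take n (u \<diamondop> v) @ drop n (u \<diamondop> v) \<in> {u \<diamondop> v | u v. Q u v}" using Q by auto
    from K[OF this] obtain z u' v' where
      z: "take n (u \<diamondop> v) @ z = u' \<diamondop> v'" "Q u' v'" "length z \<le> K" by auto
    have "take n (u' \<diamondop> v') = take n (u \<diamondop> v)" using False by (simp flip: z(1))
    then have "take n u' \<diamondop> take n v' = take n u \<diamondop> take n v" by (simp add: take_pad_pair)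
    note same = pad_pair_inject[OF this]
    have "length (u' \<diamondop> v') \<le> n + K" using z(3) by (simp flip: z(1))
    then show ?thesis using same z(2) by (auto simp: length_pad_pair)
  qed
  then show thesis by (rule that)
qed

section \<open>The word metric of a generated group\<close>

locale marked_group = group G for G :: "('g, 'm) monoid_scheme" (structure) +
  fixes A :: "'a set" and \<pi> :: "'a list \<Rightarrow> 'g"
  assumes surj: "surj_monoid_hom G A \<pi>"
begin

abbreviation E where "E \<equiv> cayley_edges G A \<pi> \<union> (cayley_edges G A \<pi>)\<inverse>"
abbreviation d where "d \<equiv> word_dist G A \<pi>"

lemma pi_closed [simp]: "u \<in> lists A \<Longrightarrow> \<pi> u \<in> carrier G"
  using surj by (auto simp: surj_monoid_hom_def epi_def hom_def free_monoid_def)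

lemma pi_Nil [simp]: "\<pi> [] = \<one>"
  using surj by (simp add: surj_monoid_hom_def)

lemma pi_append: "u \<in> lists A \<Longrightarrow> v \<in> lists A \<Longrightarrow> \<pi> (u @ v) = \<pi> u \<otimes> \<pi> v"
  using surj by (auto simp: surj_monoid_hom_def epi_def hom_def free_monoid_def)

lemma pi_onto:
  assumes "g \<in> carrier G"
  obtains w where "w \<in> lists A" "\<pi> w = g"
proof -
  have "\<pi> ` lists A = carrier G"
    using surj by (simp add: surj_monoid_hom_def epi_def free_monoid_def)
  then have "g \<in> \<pi> ` lists A" using assms by simp
  then show thesis using that by auto
qed

lemma edge_cases:
  assumes "(g, h) \<in> E"
  obtains a where "a \<in> A" "g \<in> carrier G" "h = g \<otimes> \<pi> [a]"
  | a where "a \<in> A" "h \<in> carrier G" "g = h \<otimes> \<pi> [a]"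
  using assms by (auto simp: cayley_edges_def)

lemma edge_closed: "(g, h) \<in> E \<Longrightarrow> g \<in> carrier G \<and> h \<in> carrier G"
  by (auto simp: cayley_edges_def)

lemma relpow_edge_sym: "(g, h) \<in> E ^^ n \<Longrightarrow> (h, g) \<in> E ^^ n"
proof (induction n arbitrary: h)
  case (Suc n)
  then obtain k where "(g, k) \<in> E ^^ n" "(k, h) \<in> E" by auto
  then have "(k, g) \<in> E ^^ n" "(h, k) \<in> E" using Suc.IH by auto
  then show ?case by (rule relpow_Suc_I2[rotated])
qed simp

lemma relpow_edge_translate:
  assumes k: "k \<in> carrier G"
  shows "(g, h) \<in> E ^^ n \<Longrightarrow> (k \<otimes> g, k \<otimes> h) \<in> E ^^ n"
proof (induction n arbitrary: h)
  case (Suc n)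
  then obtain l where l: "(g, l) \<in> E ^^ n" "(l, h) \<in> E" by auto
  from l(2) have "(k \<otimes> l, k \<otimes> h) \<in> E"
  proof (cases rule: edge_cases)
    case (1 a)
    then have "k \<otimes> h = (k \<otimes> l) \<otimes> \<pi> [a]" using k by (simp add: m_assoc)
    then show ?thesis using 1 k unfolding cayley_edges_def by blast
  next
    case (2 a)
    then have "k \<otimes> l = (k \<otimes> h) \<otimes> \<pi> [a]" using k by (simp add: m_assoc)
    then show ?thesis using 2 k unfolding cayley_edges_def by blast
  qed
  then show ?case using Suc.IH[OF l(1)] by auto
qed simp

lemma relpow_edge_word: "w \<in> lists A \<Longrightarrow> g \<in> carrier G \<Longrightarrow> (g, g \<otimes> \<pi> w) \<in> E ^^ length w"
proof (induction w rule: rev_induct)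
  case (snoc a w)
  then have "g \<otimes> \<pi> (w @ [a]) = (g \<otimes> \<pi> w) \<otimes> \<pi> [a]" by (simp add: pi_append m_assoc)
  then have "(g \<otimes> \<pi> w, g \<otimes> \<pi> (w @ [a])) \<in> E"
    using snoc.prems
    by (auto simp: cayley_edges_def intro!: exI[of _ "g \<otimes> \<pi> w"] exI[of _ a])
  then show ?case using snoc by auto
qed simp

lemma dist_le: "(g, h) \<in> E ^^ n \<Longrightarrow> d g h \<le> n"
  unfolding word_dist_def by (rule Least_le)

lemma dist_path:
  assumes "g \<in> carrier G" "h \<in> carrier G"
  shows "(g, h) \<in> E ^^ d g h"
proof -
  obtain w where w: "w \<in> lists A" "\<pi> w = inv g \<otimes> h"
    using pi_onto[of "inv g \<otimes> h"] assms by blast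
  then have "g \<otimes> \<pi> w = h" using assms by (simp flip: m_assoc)
  then have "(g, h) \<in> E ^^ length w" using relpow_edge_word[OF w(1) assms(1)] by simp
  then show ?thesis unfolding word_dist_def by (rule LeastI)
qed

lemma dist_word: "w \<in> lists A \<Longrightarrow> g \<in> carrier G \<Longrightarrow> d g (g \<otimes> \<pi> w) \<le> length w"
  by (intro dist_le relpow_edge_word)

lemma dist_self: "d g g = 0"
  using dist_le[of g g 0] by simp

lemma dist_sym: "g \<in> carrier G \<Longrightarrow> h \<in> carrier G \<Longrightarrow> d g h = d h g"
  by (meson dist_le dist_path relpow_edge_sym le_antisym)

lemma dist_triangle:
  assumes "g \<in> carrier G" "h \<in> carrier G" "k \<in> carrier G"
  shows "d g k \<le> d g h + d h k"
proof (rule dist_le)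
  show "(g, k) \<in> E ^^ (d g h + d h k)"
    unfolding relpow_add using dist_path assms by blast
qed

lemma dist_translate:
  assumes "g \<in> carrier G" "h \<in> carrier G" "k \<in> carrier G"
  shows "d (k \<otimes> g) (k \<otimes> h) = d g h"
proof -
  have le: "d (k \<otimes> g) (k \<otimes> h) \<le> d g h" if "k \<in> carrier G" "g \<in> carrier G" "h \<in> carrier G" for k g h
    by (intro dist_le relpow_edge_translate dist_path that)
  have "d g h \<le> d (k \<otimes> g) (k \<otimes> h)"
    using le[of "inv k" "k \<otimes> g" "k \<otimes> h"] assms by (simp flip: m_assoc)
  then show ?thesis using le[OF assms(3,1,2)] by simp
qed

lemma dist_take:
  assumes "w \<in> lists A" "m \<le> n"
  shows "d (\<pi> (take m w)) (\<pi> (take n w)) \<le> n - m"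
proof -
  have "take m w \<in> lists A" "take (n - m) (drop m w) \<in> lists A"
    using assms(1) by (auto dest: in_set_takeD in_set_dropD)
  moreover have "take n w = take m w @ take (n - m) (drop m w)"
    using take_add[of m "n - m" w] assms(2) by simp
  ultimately have "d (\<pi> (take m w)) (\<pi> (take n w)) \<le> length (take (n - m) (drop m w))"
    using dist_word[of "take (n - m) (drop m w)" "\<pi> (take m w)"] by (simp add: pi_append)
  then show ?thesis by simp
qed

lemma take_lists [simp]: "w \<in> lists A \<Longrightarrow> take n w \<in> lists A"
  by (auto dest: in_set_takeD)

section \<open>Fellow travelling from automata\<close>

text \<open>Stop both paths at time \<open>n\<close>. Some accepted pair has the same prefixes and ends at most
  \<open>K\<close> letters later; its endpoints are at distance at most \<open>c\<close>, which gives \<open>2 K + c\<close>. The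
  translation by \<open>g\<close> serves both halves of biautomaticity: \<open>g = 1\<close> for right multiplication by a
  generator, and \<open>g\<close> a generator for left multiplication.\<close>

lemma recognizable_pairs_fellow_travel:
  assumes rec: "recognizable X {u \<diamondop> v | u v. Q u v}"
    and words: "\<And>u v. Q u v \<Longrightarrow> u \<in> lists A \<and> v \<in> lists A"
    and g: "g \<in> carrier G"
    and ends: "\<And>u v. Q u v \<Longrightarrow> d (g \<otimes> \<pi> u) (\<pi> v) \<le> c"
  shows "\<exists>C. \<forall>u v n. Q u v \<longrightarrow> d (g \<otimes> \<pi> (take n u)) (\<pi> (take n v)) \<le> C"
proof -
  obtain K where K: "\<And>u v n. Q u v \<Longrightarrow> \<exists>u' v'. Q u' v' \<and> take n u' = take n u \<and>
      take n v' = take n v \<and> length u' \<le> n + K \<and> length v' \<le> n + K"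
    by (rule recognizable_pairs_bounded_completion[OF rec]) (rule that)
  have tail: "d (\<pi> (take n w)) (\<pi> w) \<le> K" if "w \<in> lists A" "length w \<le> n + K" for w n
    using dist_take[of w n "n + K"] that by simp
  have "d (g \<otimes> \<pi> (take n u)) (\<pi> (take n v)) \<le> K + c + K" if Q: "Q u v" for u v n
  proof -
    obtain u' v' where Q': "Q u' v'" and eq: "take n u' = take n u" "take n v' = take n v"
      and len: "length u' \<le> n + K" "length v' \<le> n + K" using K[OF Q] by blast
    have w: "u' \<in> lists A" "v' \<in> lists A" using words[OF Q'] by auto
    have "d (g \<otimes> \<pi> (take n u')) (g \<otimes> \<pi> u') \<le> K"
      using dist_translate tail w g len by simp
    moreover have "d (g \<otimes> \<pi> u') (\<pi> v') \<le> c" using ends Q' .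
    moreover have "d (\<pi> v') (\<pi> (take n v')) \<le> K"
      using tail[of v' n] dist_sym w len by simp
    moreover have "d (g \<otimes> \<pi> (take n u')) (\<pi> (take n v')) \<le>
        d (g \<otimes> \<pi> (take n u')) (g \<otimes> \<pi> u') + d (g \<otimes> \<pi> u') (\<pi> (take n v'))"
      using w g by (intro dist_triangle) auto
    moreover have "d (g \<otimes> \<pi> u') (\<pi> (take n v')) \<le>
        d (g \<otimes> \<pi> u') (\<pi> v') + d (\<pi> v') (\<pi> (take n v'))"
      using w g by (intro dist_triangle) auto
    ultimately show ?thesis using eq by simp
  qed
  then show ?thesis by (intro exI[of _ "K + c + K"]) simp
qed

end

lemma finite_uniform_bound:
  assumes fin: "finite S" and ex: "\<And>x. x \<in> S \<Longrightarrow> \<exists>C :: nat. P x C"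
    and up: "\<And>x C C'. P x C \<Longrightarrow> C \<le> C' \<Longrightarrow> P x C'"
  shows "\<exists>C. \<forall>x \<in> S. P x C"
  using fin ex
proof (induction S rule: finite_induct)
  case (insert y S)
  then obtain C C' where C: "\<forall>x \<in> S. P x C" "P y C'" by (metis insertI1 insertI2)
  have "P x (max C C')" if "x \<in> insert y S" for x
  proof (cases "x = y")
    case True
    then show ?thesis using up[OF C(2), of "max C C'"] by simp
  next
    case False
    then show ?thesis using up[of x C "max C C'"] C(1) that by simp
  qed
  then show ?case by blast
qed simp

lemma finite_words_at_most_one: "finite A \<Longrightarrow> finite (insert [] {[a] | a. a \<in> A})"
  by (simp add: setcompr_eq_image)

lemma automatic_structure_marked:
  assumes "automatic_structure G A \<pi> L"
  shows "marked_group G A \<pi>" "L \<subseteq> lists A" "finite A" "\<pi> ` L = carrier G"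
proof -
  have "rational A L" using assms by (simp add: automatic_structure_def)
  then show "L \<subseteq> lists A" by (rule rational_subset_lists)
qed (use assms in \<open>simp_all add: automatic_structure_def marked_group_def marked_group_axioms_def\<close>)

text \<open>Along a geodesic from \<open>\<pi> u\<close> to \<open>\<pi> v\<close> every vertex has a representative in \<open>L\<close>, and
  representatives of adjacent vertices fellow travel with one constant. The summand \<open>1\<close> accounts
  for distance zero: distinct representatives of one element still have to be compared.\<close>

lemma automatic_fellow_traveller:
  assumes aut: "automatic_structure G A \<pi> L"
  obtains C where "\<And>u v n. u \<in> L \<Longrightarrow> v \<in> L \<Longrightarrow>
    word_dist G A \<pi> (\<pi> (take n u)) (\<pi> (take n v)) \<le> C * (word_dist G A \<pi> (\<pi> u) (\<pi> v) + 1)"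
proof -
  interpret marked_group G A \<pi> using automatic_structure_marked[OF aut] by simp
  have L: "L \<subseteq> lists A" and onto: "\<pi> ` L = carrier G" and fin: "finite A"
    using automatic_structure_marked[OF aut] by auto
  let ?S = "insert [] {[a] | a. a \<in> A}"
  have "\<exists>C. \<forall>u v n. u \<in> L \<and> v \<in> L \<and> \<pi> v = \<pi> (u @ x) \<longrightarrow>
      d (\<pi> (take n u)) (\<pi> (take n v)) \<le> C" if x: "x \<in> ?S" for x
  proof -
    have xA: "x \<in> lists A" using x by auto
    have "\<exists>C. \<forall>u v n. u \<in> L \<and> v \<in> L \<and> \<pi> v = \<pi> (u @ x) \<longrightarrow>
        d (\<one>\<^bsub>G\<^esub> \<otimes>\<^bsub>G\<^esub> \<pi> (take n u)) (\<pi> (take n v)) \<le> C"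
    proof (rule recognizable_pairs_fellow_travel)
      show "recognizable (pad_alphabet A)
          {u \<diamondop> v | u v. u \<in> L \<and> v \<in> L \<and> \<pi> v = \<pi> (u @ x)}"
        using aut x unfolding automatic_structure_def by blast
      show "d (\<one>\<^bsub>G\<^esub> \<otimes>\<^bsub>G\<^esub> \<pi> u) (\<pi> v) \<le> length x" if "u \<in> L \<and> v \<in> L \<and> \<pi> v = \<pi> (u @ x)" for u v
      proof -
        have "u \<in> lists A" using that L by blast
        then show ?thesis using that xA dist_word[OF xA, of "\<pi> u"] by (simp add: pi_append)
      qed
    qed (use L in auto)
    then obtain C where C: "\<forall>u v n. u \<in> L \<and> v \<in> L \<and> \<pi> v = \<pi> (u @ x) \<longrightarrow>
        d (\<one>\<^bsub>G\<^esub> \<otimes>\<^bsub>G\<^esub> \<pi> (take n u)) (\<pi> (take n v)) \<le> C" ..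
    have "d (\<pi> (take n u)) (\<pi> (take n v)) \<le> C"
      if "u \<in> L \<and> v \<in> L \<and> \<pi> v = \<pi> (u @ x)" for u v n
    proof -
      have "u \<in> lists A" using that L by blast
      then have "\<one>\<^bsub>G\<^esub> \<otimes>\<^bsub>G\<^esub> \<pi> (take n u) = \<pi> (take n u)" by simp
      then show ?thesis using C[rule_format, OF that, of n] by simp
    qed
    then show ?thesis by (intro exI[of _ C]) simp
  qed
  then have "\<exists>C. \<forall>x \<in> ?S. \<forall>u v n. u \<in> L \<and> v \<in> L \<and> \<pi> v = \<pi> (u @ x) \<longrightarrow>
      d (\<pi> (take n u)) (\<pi> (take n v)) \<le> C"
    by (rule finite_uniform_bound[OF finite_words_at_most_one[OF fin]]) (blast, meson order_trans)
  then obtain C where C: "\<And>x u v n. x \<in> ?S \<Longrightarrow> u \<in> L \<Longrightarrow> v \<in> L \<Longrightarrow> \<pi> v = \<pi> (u @ x) \<Longrightarrow>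
      d (\<pi> (take n u)) (\<pi> (take n v)) \<le> C"
    by blast
  have path: "d (\<pi> (take n u)) (\<pi> (take n v)) \<le> C * (r + 1)"
    if "(\<pi> u, \<pi> v) \<in> E ^^ r" "u \<in> L" "v \<in> L" for r u v n
    using that
  proof (induction r arbitrary: v)
    case 0
    then show ?case using C[of "[]" u v n] by simp
  next
    case (Suc r)
    obtain k where k: "(\<pi> u, k) \<in> E ^^ r" "(k, \<pi> v) \<in> E" using Suc.prems(1) by auto
    have "k \<in> \<pi> ` L" using edge_closed[OF k(2)] onto by simp
    then obtain w where w: "w \<in> L" "\<pi> w = k" by auto
    have lists: "u \<in> lists A" "v \<in> lists A" "w \<in> lists A" using Suc.prems w L by auto
    have "d (\<pi> (take n w)) (\<pi> (take n v)) \<le> C"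
      using k(2)
    proof (cases rule: edge_cases)
      case (1 a)
      then show ?thesis using C[of "[a]" w v n] w Suc.prems lists by (simp add: pi_append)
    next
      case (2 a)
      then have "d (\<pi> (take n v)) (\<pi> (take n w)) \<le> C"
        using C[of "[a]" v w n] w Suc.prems lists by (simp add: pi_append)
      then show ?thesis using lists by (simp add: dist_sym)
    qed
    moreover have "d (\<pi> (take n u)) (\<pi> (take n w)) \<le> C * (r + 1)"
      using Suc.IH[of w] k(1) w Suc.prems by simp
    moreover have "d (\<pi> (take n u)) (\<pi> (take n v)) \<le>
        d (\<pi> (take n u)) (\<pi> (take n w)) + d (\<pi> (take n w)) (\<pi> (take n v))"
      using lists by (intro dist_triangle) auto
    ultimately show ?case by (simp add: algebra_simps)
  qed
  have "d (\<pi> (take n u)) (\<pi> (take n v)) \<le> C * (d (\<pi> u) (\<pi> v) + 1)"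
    if "u \<in> L" "v \<in> L" for u v n
  proof -
    have "u \<in> lists A" "v \<in> lists A" using that L by auto
    then show ?thesis by (intro path dist_path that pi_closed)
  qed
  then show thesis by (rule that)
qed

text \<open>The mirror image: the endpoints agree and the starting point moves along a geodesic
  from \<open>1\<close> to \<open>h\<close>, with representatives in \<open>L\<close> of the elements by which its vertices
  have to be multiplied to reach the common endpoint.\<close>

lemma biautomatic_fellow_traveller:
  assumes bi: "biautomatic_structure G A \<pi> L"
  obtains C where "\<And>h u v n. h \<in> carrier G \<Longrightarrow> u \<in> L \<Longrightarrow> v \<in> L \<Longrightarrow> \<pi> v = h \<otimes>\<^bsub>G\<^esub> \<pi> u \<Longrightarrow>
    word_dist G A \<pi> (h \<otimes>\<^bsub>G\<^esub> \<pi> (take n u)) (\<pi> (take n v)) \<le> C * (word_dist G A \<pi> \<one>\<^bsub>G\<^esub> h + 1)"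
proof -
  have aut: "automatic_structure G A \<pi> L" using bi by (simp add: biautomatic_structure_def)
  interpret marked_group G A \<pi> using automatic_structure_marked[OF aut] by simp
  have L: "L \<subseteq> lists A" and onto: "\<pi> ` L = carrier G" and fin: "finite A"
    using automatic_structure_marked[OF aut] by auto
  let ?S = "insert [] {[a] | a. a \<in> A}"
  have "\<exists>C. \<forall>u v n. u \<in> L \<and> v \<in> L \<and> \<pi> v = \<pi> (x @ u) \<longrightarrow>
      d (\<pi> x \<otimes>\<^bsub>G\<^esub> \<pi> (take n u)) (\<pi> (take n v)) \<le> C" if x: "x \<in> ?S" for x
  proof -
    have xA: "x \<in> lists A" using x by auto
    show "\<exists>C. \<forall>u v n. u \<in> L \<and> v \<in> L \<and> \<pi> v = \<pi> (x @ u) \<longrightarrow>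
        d (\<pi> x \<otimes>\<^bsub>G\<^esub> \<pi> (take n u)) (\<pi> (take n v)) \<le> C"
    proof (rule recognizable_pairs_fellow_travel)
      show "recognizable (pad_alphabet A)
          {u \<diamondop> v | u v. u \<in> L \<and> v \<in> L \<and> \<pi> v = \<pi> (x @ u)}"
        using bi x unfolding biautomatic_structure_def by blast
      show "d (\<pi> x \<otimes>\<^bsub>G\<^esub> \<pi> u) (\<pi> v) \<le> 0" if "u \<in> L \<and> v \<in> L \<and> \<pi> v = \<pi> (x @ u)" for u v
      proof -
        have "u \<in> lists A" using that L by blast
        then show ?thesis using that xA by (simp add: pi_append dist_self)
      qed
    qed (use L xA in auto)
  qed
  then have "\<exists>C. \<forall>x \<in> ?S. \<forall>u v n. u \<in> L \<and> v \<in> L \<and> \<pi> v = \<pi> (x @ u) \<longrightarrow>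
      d (\<pi> x \<otimes>\<^bsub>G\<^esub> \<pi> (take n u)) (\<pi> (take n v)) \<le> C"
    by (rule finite_uniform_bound[OF finite_words_at_most_one[OF fin]]) (blast, meson order_trans)
  then obtain C where C0: "\<And>x u v n. x \<in> ?S \<Longrightarrow> u \<in> L \<Longrightarrow> v \<in> L \<Longrightarrow> \<pi> v = \<pi> (x @ u) \<Longrightarrow>
      d (\<pi> x \<otimes>\<^bsub>G\<^esub> \<pi> (take n u)) (\<pi> (take n v)) \<le> C"
    by blast
  have C: "d (\<pi> x \<otimes>\<^bsub>G\<^esub> \<pi> (take n u)) (\<pi> (take n v)) \<le> C"
    if "x \<in> ?S" "u \<in> L" "v \<in> L" "\<pi> v = \<pi> x \<otimes>\<^bsub>G\<^esub> \<pi> u" for x u v n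
  proof -
    have "x \<in> lists A" "u \<in> lists A" using that L by auto
    then show ?thesis using C0[OF that(1-3)] that(4) by (simp add: pi_append)
  qed
  have path: "d (h \<otimes>\<^bsub>G\<^esub> \<pi> (take n u)) (\<pi> (take n v)) \<le> C * (r + 1)"
    if "(\<one>\<^bsub>G\<^esub>, h) \<in> E ^^ r" "u \<in> L" "v \<in> L" "\<pi> v = h \<otimes>\<^bsub>G\<^esub> \<pi> u" for r h u v n
    using that
  proof (induction r arbitrary: h u)
    case 0
    then show ?case using C[of "[]" u v n] by simp
  next
    case (Suc r)
    obtain k where k: "(\<one>\<^bsub>G\<^esub>, k) \<in> E ^^ r" "(k, h) \<in> E" using Suc.prems(1) by auto
    have kh: "k \<in> carrier G" "h \<in> carrier G" using edge_closed[OF k(2)] by auto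
    have lists: "u \<in> lists A" "v \<in> lists A" using Suc.prems L by auto
    obtain w where w: "w \<in> L" "\<pi> w = inv\<^bsub>G\<^esub> k \<otimes>\<^bsub>G\<^esub> (h \<otimes>\<^bsub>G\<^esub> \<pi> u)"
      using onto kh lists by (metis imageE inv_closed m_closed pi_closed)
    have wA: "w \<in> lists A" using w L by auto
    have kw: "k \<otimes>\<^bsub>G\<^esub> \<pi> w = h \<otimes>\<^bsub>G\<^esub> \<pi> u" using w kh lists by (simp flip: m_assoc)
    have "d (h \<otimes>\<^bsub>G\<^esub> \<pi> (take n u)) (k \<otimes>\<^bsub>G\<^esub> \<pi> (take n w)) \<le> C"
      using k(2)
    proof (cases rule: edge_cases)
      case (1 a)
      then have aA: "\<pi> [a] \<in> carrier G" by simp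
      have "\<pi> w = \<pi> [a] \<otimes>\<^bsub>G\<^esub> \<pi> u"
        using kw 1 aA kh wA lists by (simp add: m_assoc)
      then have "d (\<pi> [a] \<otimes>\<^bsub>G\<^esub> \<pi> (take n u)) (\<pi> (take n w)) \<le> C"
        using C[of "[a]" u w n] 1 w Suc.prems by simp
      then show ?thesis using 1 kh aA wA lists by (simp add: m_assoc dist_translate)
    next
      case (2 a)
      then have aA: "\<pi> [a] \<in> carrier G" by simp
      have "\<pi> u = \<pi> [a] \<otimes>\<^bsub>G\<^esub> \<pi> w"
        using kw 2 aA kh wA lists by (simp add: m_assoc)
      then have "d (\<pi> [a] \<otimes>\<^bsub>G\<^esub> \<pi> (take n w)) (\<pi> (take n u)) \<le> C"
        using C[of "[a]" w u n] 2 w Suc.prems by simp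
      then have "d (k \<otimes>\<^bsub>G\<^esub> \<pi> (take n w)) (h \<otimes>\<^bsub>G\<^esub> \<pi> (take n u)) \<le> C"
        using 2 kh aA wA lists by (simp add: m_assoc dist_translate)
      then show ?thesis using kh wA lists by (simp add: dist_sym)
    qed
    moreover have "d (k \<otimes>\<^bsub>G\<^esub> \<pi> (take n w)) (\<pi> (take n v)) \<le> C * (r + 1)"
      using Suc.IH[OF k(1) w(1)] Suc.prems kw by simp
    moreover have "d (h \<otimes>\<^bsub>G\<^esub> \<pi> (take n u)) (\<pi> (take n v)) \<le>
        d (h \<otimes>\<^bsub>G\<^esub> \<pi> (take n u)) (k \<otimes>\<^bsub>G\<^esub> \<pi> (take n w)) +
        d (k \<otimes>\<^bsub>G\<^esub> \<pi> (take n w)) (\<pi> (take n v))"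
      using lists wA kh by (intro dist_triangle) auto
    ultimately show ?case by (simp add: algebra_simps)
  qed
  show thesis
    by (rule that[of C], rule path[OF dist_path]) auto
qed

section \<open>Lipschitz maps, departure and concatenation\<close>

text \<open>For \<open>\<phi>\<close> the identity this compares the word metrics of two finite generating sets.\<close>

lemma hom_lipschitz:
  assumes "marked_group G A \<pi>" "marked_group H B \<sigma>" "finite A" and hom: "\<phi> \<in> hom G H"
  obtains K where "\<And>g h. g \<in> carrier G \<Longrightarrow> h \<in> carrier G \<Longrightarrow>
    word_dist H B \<sigma> (\<phi> g) (\<phi> h) \<le> K * word_dist G A \<pi> g h"
proof -
  interpret G: marked_group G A \<pi> by fact
  interpret H: marked_group H B \<sigma> by fact
  have cl: "\<phi> g \<in> carrier H" if "g \<in> carrier G" for g using hom that by (auto simp: hom_def)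
  define K where "K = Max ((\<lambda>a. H.d \<one>\<^bsub>H\<^esub> (\<phi> (\<pi> [a]))) ` A)"
  have gen: "H.d (\<phi> g) (\<phi> (g \<otimes>\<^bsub>G\<^esub> \<pi> [a])) \<le> K" if "g \<in> carrier G" "a \<in> A" for g a
  proof -
    have a: "\<pi> [a] \<in> carrier G" using that by simp
    then have "\<phi> (g \<otimes>\<^bsub>G\<^esub> \<pi> [a]) = \<phi> g \<otimes>\<^bsub>H\<^esub> \<phi> (\<pi> [a])" using hom that by (simp add: hom_def)
    then have "H.d (\<phi> g) (\<phi> (g \<otimes>\<^bsub>G\<^esub> \<pi> [a])) = H.d \<one>\<^bsub>H\<^esub> (\<phi> (\<pi> [a]))"
      using H.dist_translate[of "\<one>\<^bsub>H\<^esub>" "\<phi> (\<pi> [a])" "\<phi> g"] cl that a by simp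
    also have "\<dots> \<le> K" unfolding K_def using assms(3) that by (intro Max_ge) auto
    finally show ?thesis .
  qed
  have edge: "H.d (\<phi> k) (\<phi> h) \<le> K" if "(k, h) \<in> G.E" for k h
    using that
  proof (cases rule: G.edge_cases)
    case (1 a)
    then show ?thesis using gen by simp
  next
    case (2 a)
    then show ?thesis using gen[of h a] H.dist_sym cl G.edge_closed[OF that] by simp
  qed
  have path: "H.d (\<phi> g) (\<phi> h) \<le> K * r"
    if "(g, h) \<in> G.E ^^ r" "g \<in> carrier G" for g h r
    using that
  proof (induction r arbitrary: h)
    case 0
    then show ?case by (simp add: H.dist_self)
  next
    case (Suc r)
    obtain k where k: "(g, k) \<in> G.E ^^ r" "(k, h) \<in> G.E" using Suc.prems(1) by auto
    have "H.d (\<phi> g) (\<phi> h) \<le> H.d (\<phi> g) (\<phi> k) + H.d (\<phi> k) (\<phi> h)"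
      using G.edge_closed[OF k(2)] Suc.prems cl by (intro H.dist_triangle) auto
    then show ?case using edge[OF k(2)] Suc.IH[OF k(1) Suc.prems(2)] by simp
  qed
  show thesis by (rule that[of K], rule path[OF G.dist_path])
qed

context marked_group
begin

text \<open>At time \<open>|u|\<close> the path \<open>v\<close> is within \<open>C\<close> of \<open>\<pi> u\<close>, and at its end as well. So the part of
  \<open>v\<close> in between joins points at distance at most \<open>2 C\<close>, and the departure function
  bounds its length.\<close>

lemma departure_bounds_excess:
  assumes dep: "departure_function G A \<pi> L D"
    and uv: "u \<in> lists A" "v \<in> lists A" "v \<in> L"
    and ft: "\<And>n. d (\<pi> (take n u)) (\<pi> (take n v)) \<le> C"
  shows "length v \<le> length u + nat \<lceil>D (2 * C)\<rceil>"
proof (rule ccontr)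
  assume "\<not> ?thesis"
  then have long: "length v > length u + nat \<lceil>D (2 * C)\<rceil>" by simp
  define t where "t = length v - length u"
  have len: "length u + t = length v" "length u + t \<le> length v"
    using long by (simp_all add: t_def)
  have zero_le_double: "(0::real) \<le> 2 * C" by simp
  have "real t \<ge> D (2 * C)" using long unfolding t_def by linarith
  then have "real (d (\<pi> (take (length u) v)) (\<pi> (take (length u + t) v))) > 2 * C"
    using dep uv(3) len zero_le_double unfolding departure_function_def by blast
  then have far: "d (\<pi> (take (length u) v)) (\<pi> v) > 2 * C"
    by (simp add: len(1))
  have "d (\<pi> u) (\<pi> (take (length u) v)) \<le> C" using ft[of "length u"] by simp
  moreover have "d (\<pi> u) (\<pi> v) \<le> C" using ft[of "length v"] len by simp
  moreover have "d (\<pi> (take (length u) v)) (\<pi> v) \<le>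
      d (\<pi> (take (length u) v)) (\<pi> u) + d (\<pi> u) (\<pi> v)"
    using uv by (intro dist_triangle) auto
  ultimately show False using far uv by (simp add: dist_sym)
qed

text \<open>Between the times \<open>|u|\<close> and \<open>|u'|\<close> the first path has entered \<open>v\<close> while the second is still
  in \<open>u'\<close>; there the first path has moved at most \<open>T\<close> away from \<open>\<pi> u\<close>, and \<open>\<pi> u\<close> itself is the
  point that \<open>u\<close>, having ended, contributes to the first estimate. Afterwards both second parts
  are read with a time shift of at most \<open>T\<close>.\<close>

lemma fellow_travel_append_aux:
  assumes w: "u \<in> lists A" "v \<in> lists A" "u' \<in> lists A" "v' \<in> lists A"
    and first: "\<And>n. d (\<pi> (take n u)) (\<pi> (take n u')) \<le> C"
    and second: "\<And>n. d (\<pi> u \<otimes> \<pi> (take n v)) (\<pi> u' \<otimes> \<pi> (take n v')) \<le> C'"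
    and len: "length u \<le> length u'" "length u' \<le> length u + T"
  shows "d (\<pi> (take n (u @ v))) (\<pi> (take n (u' @ v'))) \<le> C + C' + T"
proof -
  consider "n \<le> length u" | "length u < n" "n \<le> length u'" | "length u' < n" by linarith
  then show ?thesis
  proof cases
    case 1
    then show ?thesis using first[of n] len by simp
  next
    case 2
    have "d (\<pi> (take (length u) (u @ v))) (\<pi> (take n (u @ v))) \<le> T"
      using dist_take[of "u @ v" "length u" n] 2 len w by simp
    then have "d (\<pi> (take n (u @ v))) (\<pi> u) \<le> T" using w by (simp add: dist_sym)
    moreover have "d (\<pi> u) (\<pi> (take n u')) \<le> C" using first[of n] 2 by simp
    moreover have "d (\<pi> (take n (u @ v))) (\<pi> (take n u')) \<le>
        d (\<pi> (take n (u @ v))) (\<pi> u) + d (\<pi> u) (\<pi> (take n u'))"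
      using w by (intro dist_triangle) (auto simp del: take_append)
    ultimately show ?thesis using 2 by simp
  next
    case 3
    define k where "k = n - length u"
    define l where "l = n - length u'"
    have kl: "l \<le> k" "k - l \<le> T" using len unfolding k_def l_def by auto
    have eq: "\<pi> (take n (u @ v)) = \<pi> u \<otimes> \<pi> (take k v)"
      "\<pi> (take n (u' @ v')) = \<pi> u' \<otimes> \<pi> (take l v')"
      using 3 len w by (simp_all add: pi_append k_def l_def)
    have "d (\<pi> u' \<otimes> \<pi> (take k v')) (\<pi> u' \<otimes> \<pi> (take l v')) \<le> T"
      using dist_take[of v' l k] kl w by (simp add: dist_translate dist_sym)
    moreover have "d (\<pi> u \<otimes> \<pi> (take k v)) (\<pi> u' \<otimes> \<pi> (take l v')) \<le>
        d (\<pi> u \<otimes> \<pi> (take k v)) (\<pi> u' \<otimes> \<pi> (take k v')) +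
        d (\<pi> u' \<otimes> \<pi> (take k v')) (\<pi> u' \<otimes> \<pi> (take l v'))"
      using w by (intro dist_triangle) auto
    ultimately show ?thesis using second[of k] eq by simp
  qed
qed

lemma fellow_travel_append:
  assumes w: "u \<in> lists A" "v \<in> lists A" "u' \<in> lists A" "v' \<in> lists A"
    and first: "\<And>n. d (\<pi> (take n u)) (\<pi> (take n u')) \<le> C"
    and second: "\<And>n. d (\<pi> u \<otimes> \<pi> (take n v)) (\<pi> u' \<otimes> \<pi> (take n v')) \<le> C'"
    and len: "length u \<le> length u' + T" "length u' \<le> length u + T"
  shows "d (\<pi> (take n (u @ v))) (\<pi> (take n (u' @ v'))) \<le> C + C' + T"
proof (cases "length u \<le> length u'")
  case True
  then show ?thesis using fellow_travel_append_aux[OF w first second] len by simp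
next
  case False
  have "d (\<pi> (take n u')) (\<pi> (take n u)) \<le> C" for n
    using first[of n] w by (simp add: dist_sym)
  moreover have "d (\<pi> u' \<otimes> \<pi> (take n v')) (\<pi> u \<otimes> \<pi> (take n v)) \<le> C'" for n
    using second[of n] w by (simp add: dist_sym)
  ultimately have "d (\<pi> (take n (u' @ v'))) (\<pi> (take n (u @ v))) \<le> C + C' + T"
    using fellow_travel_append_aux[OF w(3,4,1,2)] False len by simp
  then show ?thesis using w by (simp add: dist_sym del: take_append)
qed

end

section \<open>The bounded reduction property\<close>

text \<open>The gluing step in isolation. Given that the corner \<open>\<pi> v\<close> of the triangle is within \<open>R\<close> of a
  vertex \<open>\<pi> (take j z)\<close> of the side \<open>z\<close>, the constant depends only on \<open>R\<close>.\<close>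

lemma f_biautomatic_triangle:
  assumes fbi: "f_biautomatic_structure G B \<pi> L" and dep: "departure_function G B \<pi> L D"
  obtains q where "\<And>v w z j n. v \<in> L \<Longrightarrow> w \<in> L \<Longrightarrow> z \<in> L \<Longrightarrow> \<pi> (v @ w) = \<pi> z \<Longrightarrow>
    word_dist G B \<pi> (\<pi> v) (\<pi> (take j z)) \<le> R \<Longrightarrow>
    word_dist G B \<pi> (\<pi> (take n (v @ w))) (\<pi> (take n z)) \<le> q"
proof -
  have bi: "biautomatic_structure G B \<pi> L" and fac: "factorial_language L"
    using fbi by (auto simp: f_biautomatic_structure_def)
  have aut: "automatic_structure G B \<pi> L" using bi by (simp add: biautomatic_structure_def)
  interpret marked_group G B \<pi> using automatic_structure_marked[OF aut] by simp
  have L: "L \<subseteq> lists B" using automatic_structure_marked[OF aut] by simp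
  obtain C where C: "\<And>u v n. u \<in> L \<Longrightarrow> v \<in> L \<Longrightarrow>
      d (\<pi> (take n u)) (\<pi> (take n v)) \<le> C * (d (\<pi> u) (\<pi> v) + 1)"
    by (rule automatic_fellow_traveller[OF aut]) (rule that)
  obtain C' where C': "\<And>h u v n. h \<in> carrier G \<Longrightarrow> u \<in> L \<Longrightarrow> v \<in> L \<Longrightarrow> \<pi> v = h \<otimes>\<^bsub>G\<^esub> \<pi> u \<Longrightarrow>
      d (h \<otimes>\<^bsub>G\<^esub> \<pi> (take n u)) (\<pi> (take n v)) \<le> C' * (d \<one>\<^bsub>G\<^esub> h + 1)"
    by (rule biautomatic_fellow_traveller[OF bi]) (rule that)
  define C1 where "C1 = C * (R + 1)"
  define C2 where "C2 = C' * (R + 1)"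
  define T where "T = nat \<lceil>D (2 * C1)\<rceil>"
  have "d (\<pi> (take n (v @ w))) (\<pi> (take n z)) \<le> C1 + C2 + T"
    if vwz: "v \<in> L" "w \<in> L" "z \<in> L" and tri: "\<pi> (v @ w) = \<pi> z"
      and near: "d (\<pi> v) (\<pi> (take j z)) \<le> R" for v w z j n
  proof -
    define a where "a = take j z"
    define b where "b = drop j z"
    have z: "z = a @ b" by (simp add: a_def b_def)
    have "[] @ a @ b \<in> L" "a @ b @ [] \<in> L" using vwz(3) z by auto
    then have ab: "a \<in> L" "b \<in> L" using fac unfolding factorial_language_def by blast+
    have lists: "v \<in> lists B" "w \<in> lists B" "a \<in> lists B" "b \<in> lists B" using vwz ab L by auto
    have near: "d (\<pi> v) (\<pi> a) \<le> R" using near by (simp add: a_def)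
    have first: "d (\<pi> (take n v)) (\<pi> (take n a)) \<le> C1" for n
      unfolding C1_def using near
      by (intro order_trans[OF C[OF vwz(1) ab(1)]] mult_le_mono2) simp
    define h where "h = inv\<^bsub>G\<^esub> \<pi> v \<otimes>\<^bsub>G\<^esub> \<pi> a"
    have h: "h \<in> carrier G" "\<pi> v \<otimes>\<^bsub>G\<^esub> h = \<pi> a"
      using lists by (simp_all add: h_def flip: m_assoc)
    have "\<pi> v \<otimes>\<^bsub>G\<^esub> \<pi> w = \<pi> v \<otimes>\<^bsub>G\<^esub> (h \<otimes>\<^bsub>G\<^esub> \<pi> b)"
      using tri h lists by (simp add: z pi_append flip: m_assoc)
    then have wb: "\<pi> w = h \<otimes>\<^bsub>G\<^esub> \<pi> b" using lists h by simp
    have "d \<one>\<^bsub>G\<^esub> h = d (\<pi> v) (\<pi> a)"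
      using dist_translate[of "\<one>\<^bsub>G\<^esub>" h "\<pi> v"] h lists by simp
    then have "d (h \<otimes>\<^bsub>G\<^esub> \<pi> (take n b)) (\<pi> (take n w)) \<le> C2" for n
      unfolding C2_def using near
      by (intro order_trans[OF C'[OF h(1) ab(2) vwz(2) wb]] mult_le_mono2) simp
    moreover have "d (\<pi> v \<otimes>\<^bsub>G\<^esub> \<pi> (take n w)) (\<pi> a \<otimes>\<^bsub>G\<^esub> \<pi> (take n b)) =
        d (h \<otimes>\<^bsub>G\<^esub> \<pi> (take n b)) (\<pi> (take n w))" for n
      using dist_translate[of "\<pi> (take n w)" "h \<otimes>\<^bsub>G\<^esub> \<pi> (take n b)" "\<pi> v"] h lists
      by (simp add: dist_sym flip: m_assoc)
    ultimately have second: "d (\<pi> v \<otimes>\<^bsub>G\<^esub> \<pi> (take n w)) (\<pi> a \<otimes>\<^bsub>G\<^esub> \<pi> (take n b)) \<le> C2" for n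
      by simp
    have first': "d (\<pi> (take n a)) (\<pi> (take n v)) \<le> C1" for n
      using first[of n] lists by (simp add: dist_sym)
    have len: "length v \<le> length a + T" "length a \<le> length v + T"
      unfolding T_def
      using departure_bounds_excess[OF dep lists(3,1) vwz(1) first']
        departure_bounds_excess[OF dep lists(1,3) ab(1) first] by auto
    show ?thesis unfolding z by (rule fellow_travel_append[OF lists first second len])
  qed
  then show thesis by (rule that)
qed

theorem proposition3p7:
  fixes G :: "('g, 'm) monoid_scheme"
    and A :: "'a set" and \<pi>\<^sub>1 :: "'a list \<Rightarrow> 'g" and L\<^sub>1 :: "'a list set"
    and B :: "'b set" and \<pi>\<^sub>2 :: "'b list \<Rightarrow> 'g" and L\<^sub>2 :: "'b list set"
    and D :: "real \<Rightarrow> real" and \<phi> :: "'g \<Rightarrow> 'g" and N :: nat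
  assumes "biautomatic_group G"
    and "automatic_structure G A \<pi>\<^sub>1 L\<^sub>1"
    and "f_biautomatic_structure G B \<pi>\<^sub>2 L\<^sub>2"
    and "departure_function G B \<pi>\<^sub>2 L\<^sub>2 D"
    and "\<phi> \<in> hom G G"
    and "\<And>\<alpha> x \<beta>. \<alpha> \<in> L\<^sub>1 \<Longrightarrow> x \<in> carrier G \<Longrightarrow> \<beta> \<in> L\<^sub>2 \<Longrightarrow> \<pi>\<^sub>2 \<beta> = \<phi> (\<pi>\<^sub>1 \<alpha>) \<Longrightarrow>
           \<phi> ` theta_image G \<pi>\<^sub>1 x \<alpha> \<subseteq> nbhd G A \<pi>\<^sub>1 (real N) (theta_image G \<pi>\<^sub>2 (\<phi> x) \<beta>)"
  shows "FT_BRP G A \<pi>\<^sub>1 B \<pi>\<^sub>2 \<phi> L\<^sub>1 L\<^sub>2"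
proof -
  have aut2: "automatic_structure G B \<pi>\<^sub>2 L\<^sub>2"
    using assms(3) by (simp add: f_biautomatic_structure_def biautomatic_structure_def)
  note mA = automatic_structure_marked[OF assms(2)]
  note mB = automatic_structure_marked[OF aut2]
  interpret A: marked_group G A \<pi>\<^sub>1 by (fact mA(1))
  interpret B: marked_group G B \<pi>\<^sub>2 by (fact mB(1))
  have hom: "\<phi> g \<in> carrier G" "\<phi> (g \<otimes>\<^bsub>G\<^esub> h) = \<phi> g \<otimes>\<^bsub>G\<^esub> \<phi> h"
    if "g \<in> carrier G" "h \<in> carrier G" for g h
    using assms(5) that by (auto simp: hom_def)
  have one: "\<phi> \<one>\<^bsub>G\<^esub> = \<one>\<^bsub>G\<^esub>" using hom_one[OF assms(5)] A.is_group by simp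
  obtain K where K: "\<And>g h. g \<in> carrier G \<Longrightarrow> h \<in> carrier G \<Longrightarrow> B.d (\<phi> g) (\<phi> h) \<le> K * A.d g h"
    by (rule hom_lipschitz[OF mA(1) mB(1) mA(3) assms(5)]) (rule that)
  \<comment> \<open>The neighbourhoods are measured in the metric of \<open>A\<close>, fellow travelling in that of \<open>B\<close>.\<close>
  have "(\<lambda>g. g) \<in> hom G G" by (simp add: hom_def)
  then obtain I where I: "\<And>g h. g \<in> carrier G \<Longrightarrow> h \<in> carrier G \<Longrightarrow> B.d g h \<le> I * A.d g h"
    by (rule hom_lipschitz[OF mA(1) mB(1) mA(3)]) (rule that)
  show ?thesis
    unfolding FT_BRP_def
  proof (intro allI impI)
    fix p :: real
    assume "p \<ge> 0"
    define R where "R = K * nat \<lfloor>p\<rfloor> + I * N"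
    obtain q where q: "\<And>v w z j n. v \<in> L\<^sub>2 \<Longrightarrow> w \<in> L\<^sub>2 \<Longrightarrow> z \<in> L\<^sub>2 \<Longrightarrow> \<pi>\<^sub>2 (v @ w) = \<pi>\<^sub>2 z \<Longrightarrow>
        B.d (\<pi>\<^sub>2 v) (\<pi>\<^sub>2 (take j z)) \<le> R \<Longrightarrow> B.d (\<pi>\<^sub>2 (take n (v @ w))) (\<pi>\<^sub>2 (take n z)) \<le> q"
      by (rule f_biautomatic_triangle[OF assms(3,4)]) (rule that)
    have "MFT G B \<pi>\<^sub>2 (real q) (v\<^sub>1 @ v\<^sub>2) v\<^sub>3"
      if u: "u\<^sub>1 \<in> L\<^sub>1" "u\<^sub>2 \<in> L\<^sub>1" "u\<^sub>3 \<in> L\<^sub>1" and v: "v\<^sub>1 \<in> L\<^sub>2" "v\<^sub>2 \<in> L\<^sub>2" "v\<^sub>3 \<in> L\<^sub>2"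
        and img: "\<pi>\<^sub>2 v\<^sub>1 = \<phi> (\<pi>\<^sub>1 u\<^sub>1)" "\<pi>\<^sub>2 v\<^sub>2 = \<phi> (\<pi>\<^sub>1 u\<^sub>2)" "\<pi>\<^sub>2 v\<^sub>3 = \<phi> (\<pi>\<^sub>1 u\<^sub>3)"
        and mft: "MFT G A \<pi>\<^sub>1 p (u\<^sub>1 @ u\<^sub>2) u\<^sub>3" for u\<^sub>1 u\<^sub>2 u\<^sub>3 v\<^sub>1 v\<^sub>2 v\<^sub>3
    proof -
      have lists: "u\<^sub>1 \<in> lists A" "u\<^sub>2 \<in> lists A" "u\<^sub>3 \<in> lists A"
          "v\<^sub>1 \<in> lists B" "v\<^sub>2 \<in> lists B" "v\<^sub>3 \<in> lists B"
        using u v mA(2) mB(2) by auto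
      have "\<pi>\<^sub>1 (u\<^sub>1 @ u\<^sub>2) = \<pi>\<^sub>1 u\<^sub>3" using mft by (simp add: MFT_def)
      then have "\<phi> (\<pi>\<^sub>1 u\<^sub>1 \<otimes>\<^bsub>G\<^esub> \<pi>\<^sub>1 u\<^sub>2) = \<phi> (\<pi>\<^sub>1 u\<^sub>3)" using lists by (simp add: A.pi_append)
      then have tri: "\<pi>\<^sub>2 (v\<^sub>1 @ v\<^sub>2) = \<pi>\<^sub>2 v\<^sub>3" using lists hom(2) img by (simp add: B.pi_append)
      define g where "g = \<pi>\<^sub>1 (take (length u\<^sub>1) u\<^sub>3)"
      have g: "g \<in> carrier G" using lists by (simp add: g_def)
      have "real (A.d (\<pi>\<^sub>1 (take (length u\<^sub>1) (u\<^sub>1 @ u\<^sub>2))) g) \<le> p"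
        using mft unfolding MFT_def fellow_travel_def g_def by blast
      then have "A.d (\<pi>\<^sub>1 u\<^sub>1) g \<le> nat \<lfloor>p\<rfloor>" by (simp add: le_nat_floor)
      then have corner: "B.d (\<pi>\<^sub>2 v\<^sub>1) (\<phi> g) \<le> K * nat \<lfloor>p\<rfloor>"
        unfolding img(1) using g lists by (intro order_trans[OF K] mult_le_mono2) auto
      \<comment> \<open>The prefix may already be all of \<open>u\<^sub>3\<close>, so the time at which it ends is a minimum.\<close>
      have "g = theta G \<pi>\<^sub>1 \<one>\<^bsub>G\<^esub> u\<^sub>3 (min (length u\<^sub>1) (length u\<^sub>3))"
        using g unfolding theta_def g_def by (cases "length u\<^sub>1 \<le> length u\<^sub>3") auto
      then have "g \<in> theta_image G \<pi>\<^sub>1 \<one>\<^bsub>G\<^esub> u\<^sub>3" unfolding theta_image_def by auto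
      then have "\<phi> g \<in> nbhd G A \<pi>\<^sub>1 (real N) (theta_image G \<pi>\<^sub>2 \<one>\<^bsub>G\<^esub> v\<^sub>3)"
        using assms(6)[OF u(3) A.one_closed v(3) img(3)] one by auto
      then have Y: "theta_image G \<pi>\<^sub>2 \<one>\<^bsub>G\<^esub> v\<^sub>3 \<noteq> {}"
          "(INF y\<in>theta_image G \<pi>\<^sub>2 \<one>\<^bsub>G\<^esub> v\<^sub>3. A.d (\<phi> g) y) \<le> N"
        by (auto simp: nbhd_def)
      have "(INF y\<in>theta_image G \<pi>\<^sub>2 \<one>\<^bsub>G\<^esub> v\<^sub>3. A.d (\<phi> g) y) \<in>
          A.d (\<phi> g) ` theta_image G \<pi>\<^sub>2 \<one>\<^bsub>G\<^esub> v\<^sub>3"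
        using Y(1) by (intro Inf_nat_def1) simp
      then obtain y where "y \<in> theta_image G \<pi>\<^sub>2 \<one>\<^bsub>G\<^esub> v\<^sub>3" "A.d (\<phi> g) y \<le> N"
        using Y(2) by auto
      then obtain j where j: "A.d (\<phi> g) (\<pi>\<^sub>2 (take j v\<^sub>3)) \<le> N"
        using lists by (auto simp: theta_image_def theta_def)
      have "B.d (\<phi> g) (\<pi>\<^sub>2 (take j v\<^sub>3)) \<le> I * N"
        using j hom(1) g lists by (intro order_trans[OF I] mult_le_mono2) auto
      moreover have "B.d (\<pi>\<^sub>2 v\<^sub>1) (\<pi>\<^sub>2 (take j v\<^sub>3)) \<le>
          B.d (\<pi>\<^sub>2 v\<^sub>1) (\<phi> g) + B.d (\<phi> g) (\<pi>\<^sub>2 (take j v\<^sub>3))"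
        using lists hom(1) g by (intro B.dist_triangle) auto
      ultimately have "B.d (\<pi>\<^sub>2 v\<^sub>1) (\<pi>\<^sub>2 (take j v\<^sub>3)) \<le> R" using corner unfolding R_def by simp
      then have "B.d (\<pi>\<^sub>2 (take n (v\<^sub>1 @ v\<^sub>2))) (\<pi>\<^sub>2 (take n v\<^sub>3)) \<le> q" for n
        using q v tri by blast
      then show ?thesis using tri unfolding MFT_def fellow_travel_def by (simp del: take_append)
    qed
    then show "\<exists>q\<ge>0. \<forall>u\<^sub>1\<in>L\<^sub>1. \<forall>u\<^sub>2\<in>L\<^sub>1. \<forall>u\<^sub>3\<in>L\<^sub>1. \<forall>v\<^sub>1\<in>L\<^sub>2. \<forall>v\<^sub>2\<in>L\<^sub>2. \<forall>v\<^sub>3\<in>L\<^sub>2.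
        \<pi>\<^sub>2 v\<^sub>1 = \<phi> (\<pi>\<^sub>1 u\<^sub>1) \<and> \<pi>\<^sub>2 v\<^sub>2 = \<phi> (\<pi>\<^sub>1 u\<^sub>2) \<and> \<pi>\<^sub>2 v\<^sub>3 = \<phi> (\<pi>\<^sub>1 u\<^sub>3) \<and>
        MFT G A \<pi>\<^sub>1 p (u\<^sub>1 @ u\<^sub>2) u\<^sub>3 \<longrightarrow> MFT G B \<pi>\<^sub>2 q (v\<^sub>1 @ v\<^sub>2) v\<^sub>3"
      by (intro exI[of _ "real q"]) simp
  qed
qed

end
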